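(* For every integer $n\ge1$, $spt_o^{+}(2n)\equiv spt(n)\pmod 2$.
   Context: For a nonempty integer partition $\pi$, let $s(\pi)$ be its smallest part. $spt_o^{+}(m)$ is the total number of occurrences of the smallest part, summed over all partitions $\pi$ of $m$ in which no odd part is greater than $2s(\pi)$. $spt(n)$ is the total number of occurrences of the smallest part, summed over all partitions of $n$. *)

theory Defs
  imports "HOL-Library.Multiset" "HOL-Number_Theory.Cong"
begin

text \<open>
  An integer partition of \<open>n\<close> is the multiset of its parts.
\<close>

definition partitions_of :: "nat \<Rightarrow> nat multiset set" where
  "partitions_of n = {p. (\<forall>x \<in># p. 0 < x) \<and> sum_mset p = n}"

text \<open>
  \<open>Min\<close> is unspecified on the empty set, so \<open>smallest_part\<close> is meaningful for nonempty
  partitions only. The empty partition is the only partition of \<open>0\<close>, and it contributes nothing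
  to the sums below, because all its multiplicities are \<open>0\<close>.
\<close>

definition smallest_part :: "nat multiset \<Rightarrow> nat" where
  "smallest_part p = Min (set_mset p)"

definition spt :: "nat \<Rightarrow> nat" where
  "spt n = (\<Sum>p \<in> partitions_of n. count p (smallest_part p))"

definition spt_o_plus :: "nat \<Rightarrow> nat" where
  "spt_o_plus m =
     (\<Sum>p \<in> {p \<in> partitions_of m. \<forall>x \<in># p. odd x \<longrightarrow> \<not> x > 2 * smallest_part p}.
        count p (smallest_part p))"

text \<open>The index sets of these sums are finite, so the sums do not collapse to \<open>0\<close>.\<close>

lemma finite_partitions_of: "finite (partitions_of n)"
proof (rule finite_subset)
  show "partitions_of n \<subseteq> mset ` {xs. set xs \<subseteq> {..n} \<and> length xs \<le> n}"
  proof
    fix p assume p: "p \<in> partitions_of n"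
    then have pos: "\<forall>x \<in># p. 0 < x" and n: "sum_mset p = n"
      by (simp_all add: partitions_of_def)
    obtain xs where xs: "p = mset xs"
      using ex_mset by metis
    have "size p \<le> sum_mset p"
      using pos by (induction p) auto
    moreover have "x \<le> sum_mset p" if "x \<in># p" for x
      using that by (auto dest!: multi_member_split)
    ultimately have "set xs \<subseteq> {..n} \<and> length xs \<le> n"
      using n xs by auto
    then show "p \<in> mset ` {xs. set xs \<subseteq> {..n} \<and> length xs \<le> n}"
      using xs by blast
  qed
  show "finite (mset ` {xs. set xs \<subseteq> {..n} \<and> length xs \<le> n})"
    by (intro finite_imageI finite_lists_length_le) simp
qed

end

theory Submission
  imports Defs "HOL-Computational_Algebra.Formal_Power_Series" "HOL-Library.Z2"
begin

text \<open>
  Work with formal power series over the field with two elements, where squaring a series is the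
  substitution of \<open>X\<^sup>2\<close> for \<open>X\<close>. Write \<open>N m\<close> for the generating function of the partitions
  into parts greater than \<open>m\<close>, and \<open>h\<close>, \<open>F\<close> for the generating functions of \<open>spt\<close> and
  \<open>spt_o_plus\<close>. Summing over the smallest part \<open>s\<close>, expanding one factor of each term in powers of
  \<open>X\<^sup>2\<^sup>s\<close> by the q-binomial theorem and exchanging the summations gives
  \<open>h = (N 0)\<^sup>2 (\<Sum>m. (N (2 m) - 1) / (N m)\<^sup>2) / N 0\<close> and
  \<open>F = (N 0)\<^sup>2 (\<Sum>m. N (2 m) (N (2 m) - 1) / (N m)\<^sup>4)\<close>, whence
  \<open>F - h\<^sup>2 = (N 0)\<^sup>2 (\<Sum>m. (1 - N (2 m)) / (N m)\<^sup>4)\<close>.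
  A telescoping argument shows that the last sum is \<open>L\<^sup>2 - L\<close>, where \<open>L\<close> generates the number of odd
  divisors. As \<open>2 n\<close> and \<open>n\<close> have the same odd divisors, its coefficients of even index vanish, and
  so do those of \<open>F - h\<^sup>2\<close>. Finally, the coefficient of \<open>h\<^sup>2\<close> at \<open>2 n\<close> is that of \<open>h\<close> at \<open>n\<close>.
\<close>

unbundle fps_syntax

section \<open>Power series modulo powers of X\<close>

lemma fps_X_power_dvd_iff:
  fixes f :: "'a::comm_ring_1 fps"
  shows "fps_X ^ n dvd f \<longleftrightarrow> (\<forall>k<n. f $ k = 0)"
proof
  assume "fps_X ^ n dvd f"
  then show "\<forall>k<n. f $ k = 0"
    by (auto simp: dvd_def fps_X_power_mult_nth)
next
  assume "\<forall>k<n. f $ k = 0"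
  then have "f = fps_X ^ n * fps_shift n f"
    by (auto simp: fps_eq_iff fps_X_power_mult_nth)
  then show "fps_X ^ n dvd f"
    by (rule dvdI)
qed

lemma fps_X_power_dvd_inverse_minus_1:
  fixes f :: "'a::field fps"
  assumes "f $ 0 = 1" "fps_X ^ n dvd f - 1"
  shows "fps_X ^ n dvd inverse f - 1"
proof -
  have "inverse f - 1 = - inverse f * (f - 1)"
    using inverse_mult_eq_1[of f] assms(1) by (simp add: algebra_simps)
  then show ?thesis
    using assms(2) by (metis dvd_mult)
qed

lemma fps_X_power_dvd_mult_minus_1:
  fixes f g :: "'a::comm_ring_1 fps"
  assumes "fps_X ^ n dvd f - 1" "fps_X ^ n dvd g - 1"
  shows "fps_X ^ n dvd f * g - 1"
proof -
  have "f * g - 1 = (f - 1) * g + (g - 1)"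
    by (simp add: algebra_simps)
  moreover have "fps_X ^ n dvd (f - 1) * g + (g - 1)"
    by (intro dvd_add dvd_mult2 assms)
  ultimately show ?thesis
    by metis
qed

text \<open>As \<open>w i\<close> is invertible, divisibility by X^n passes from
  \<open>d (Suc i)\<close> down to \<open>d i\<close>. Starting at \<open>d n\<close> with n
  arbitrarily large, every power of X divides \<open>d i\<close>. This serves as the uniqueness
  principle for q-difference equations.\<close>

lemma fps_eq_0_if_recurrence:
  fixes d :: "nat \<Rightarrow> 'a::field fps"
  assumes rec: "\<And>i. w i * d i = u i * d (Suc i)"
    and unit: "\<And>i. w i $ 0 \<noteq> 0" and small: "\<And>i. fps_X ^ i dvd d i"
  shows "d i = 0"
proof -
  have *: "fps_X ^ n dvd d i" if "i \<le> n" for i n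
    using that
  proof (induction rule: inc_induct)
    case base
    show ?case by (rule small)
  next
    case (step i)
    then have "fps_X ^ n dvd w i * d i"
      by (simp add: rec)
    moreover have "d i = inverse (w i) * (w i * d i)"
      using inverse_mult_eq_1[OF unit[of i]] by (simp flip: mult.assoc)
    ultimately show ?case
      by (metis dvd_mult)
  qed
  have "d i $ k = 0" for k
    using *[of i "i + k + 1"] unfolding fps_X_power_dvd_iff by simp
  then show ?thesis
    by (simp add: fps_eq_iff)
qed

subsection \<open>Formal series\<close>

text \<open>The sum of the series with terms \<open>f n\<close>, provided that \<open>f n\<close> is divisible by \<open>X\<^sup>n\<close>.\<close>

definition fps_series :: "(nat \<Rightarrow> 'a::comm_ring_1 fps) \<Rightarrow> 'a fps" where
  "fps_series f = Abs_fps (\<lambda>k. \<Sum>n\<le>k. f n $ k)"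

lemma fps_series_nth:
  assumes "\<And>n. fps_X ^ n dvd f n" "k \<le> N"
  shows "fps_series f $ k = (\<Sum>n\<le>N. f n $ k)"
  unfolding fps_series_def fps_nth_Abs_fps
  by (rule sum.mono_neutral_left) (use assms in \<open>auto simp: fps_X_power_dvd_iff\<close>)

lemma fps_series_diff: "fps_series (\<lambda>n. f n - g n) = fps_series f - fps_series g"
  by (simp add: fps_series_def fps_eq_iff sum_subtractf)

lemma fps_series_mult_left:
  assumes "\<And>n. fps_X ^ n dvd f n"
  shows "fps_series (\<lambda>n. c * f n) = c * fps_series f"
proof (rule fps_ext)
  fix k
  have "(c * fps_series f) $ k = (\<Sum>i=0..k. \<Sum>n\<le>k. c $ i * f n $ (k - i))"
    by (auto simp: fps_mult_nth fps_series_nth[OF assms, where N = k] sum_distrib_left)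
  also have "\<dots> = (\<Sum>n\<le>k. \<Sum>i=0..k. c $ i * f n $ (k - i))"
    by (rule sum.swap)
  finally show "fps_series (\<lambda>n. c * f n) $ k = (c * fps_series f) $ k"
    by (simp add: fps_series_def fps_mult_nth)
qed

lemma fps_series_Suc:
  assumes "\<And>n. fps_X ^ n dvd f n"
  shows "fps_series f = f 0 + fps_series (\<lambda>n. f (Suc n))"
proof (rule fps_ext)
  fix k
  have "fps_series f $ k = (\<Sum>n\<le>Suc k. f n $ k)"
    by (rule fps_series_nth[OF assms]) simp
  also have "\<dots> = f 0 $ k + (\<Sum>n\<le>k. f (Suc n) $ k)"
    by (rule sum.atMost_Suc_shift)
  finally show "fps_series f $ k = (f 0 + fps_series (\<lambda>n. f (Suc n))) $ k"
    by (simp add: fps_series_def)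
qed

text \<open>On both sides the coefficient of X^k is a sum over the square n, m \<le> k, so only
  finite sums are exchanged.\<close>

lemma fps_series_swap:
  "fps_series (\<lambda>n. fps_series (f n)) = fps_series (\<lambda>m. fps_series (\<lambda>n. f n m))"
  unfolding fps_series_def fps_nth_Abs_fps by (subst sum.swap) (rule refl)

lemma fps_X_power_dvd_series:
  assumes "\<And>n. fps_X ^ N dvd f n"
  shows "fps_X ^ N dvd fps_series f"
  using assms by (auto simp: fps_X_power_dvd_iff fps_series_def)

text \<open>The hypothesis makes \<open>t n\<close> converge X-adically to \<open>c\<close>. At
  degree k the first k + 1 differences already telescope to a term that agrees with
  \<open>c\<close>.\<close>

lemma fps_series_telescope:
  fixes t :: "nat \<Rightarrow> 'a::comm_ring_1 fps"
  assumes "\<And>n. fps_X ^ n dvd t n - c"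
  shows "fps_series (\<lambda>n. t (Suc n) - t n) = c - t 0"
proof (rule fps_ext)
  fix k
  have "fps_series (\<lambda>n. t (Suc n) - t n) $ k = (\<Sum>n<Suc k. t (Suc n) $ k - t n $ k)"
    unfolding lessThan_Suc_atMost by (simp add: fps_series_def)
  also have "\<dots> = t (Suc k) $ k - t 0 $ k"
    by (rule sum_lessThan_telescope)
  also have "t (Suc k) $ k = c $ k"
    using assms[of "Suc k"] unfolding fps_X_power_dvd_iff by simp
  finally show "fps_series (\<lambda>n. t (Suc n) - t n) $ k = (c - t 0) $ k"
    by simp
qed

subsection \<open>Generating functions of partitions\<close>

definition partitions_in :: "nat set \<Rightarrow> nat \<Rightarrow> nat multiset set" where
  "partitions_in A n = {p \<in> partitions_of n. set_mset p \<subseteq> A}"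

lemma finite_partitions_in [simp]: "finite (partitions_in A n)"
  by (simp add: partitions_in_def finite_partitions_of)

lemma partition_part_bounds:
  assumes "p \<in> partitions_of n" "x \<in># p"
  shows "0 < x" "x \<le> n"
  using assms by (auto simp: partitions_of_def dest!: multi_member_split)

text \<open>Removing one copy of \<open>a\<close> inverts \<open>add_mset a\<close>. This underlies
  the recurrences both for the number of partitions and for the multiplicity of
  \<open>a\<close>.\<close>

lemma partitions_in_containing:
  assumes "a \<in> A" "0 < a"
  shows "{p \<in> partitions_in A n. a \<in># p} =
    (if a \<le> n then add_mset a ` partitions_in A (n - a) else {})"
proof -
  have "p \<in> add_mset a ` partitions_in A (n - a)" if "p \<in> partitions_in A n" "a \<in># p" for p
    using that by (auto simp: partitions_in_def partitions_of_def dest!: multi_member_split)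
  moreover have "a \<le> n" if "p \<in> partitions_in A n" "a \<in># p" for p
    using that partition_part_bounds(2)[of p n a] by (simp add: partitions_in_def)
  moreover have "add_mset a q \<in> partitions_in A n" if "q \<in> partitions_in A (n - a)" "a \<le> n" for q
    using that assms by (simp add: partitions_in_def partitions_of_def)
  ultimately show ?thesis
    by auto
qed

lemma sum_partitions_in_count:
  assumes "a \<in> A" "0 < a"
  shows "(\<Sum>p\<in>partitions_in A n. count p a) =
    (if a \<le> n then \<Sum>p\<in>partitions_in A (n - a). Suc (count p a) else 0)"
proof -
  have "(\<Sum>p\<in>partitions_in A n. count p a) = (\<Sum>p\<in>{p \<in> partitions_in A n. a \<in># p}. count p a)"
    by (rule sum.mono_neutral_right) (auto simp: not_in_iff)
  then show ?thesis
    by (simp add: partitions_in_containing[OF assms] sum.reindex inj_on_def)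
qed

text \<open>For positive parts this is the product of 1 / (1 - X^a) over a in \<open>A\<close>.
  Defining it by coefficients lets \<open>A\<close> be infinite; the factors appear through
  \<open>part_gf_insert\<close>.\<close>

definition part_gf :: "nat set \<Rightarrow> 'a::field fps" where
  "part_gf A = Abs_fps (\<lambda>n. of_nat (card (partitions_in A n)))"

lemma partitions_in_0 [simp]: "partitions_in A 0 = {{#}}"
proof -
  have "p = {#}" if "p \<in> partitions_of 0" for p
    using partition_part_bounds[OF that] by (metis multiset_nonemptyE not_le)
  then show ?thesis
    by (auto simp: partitions_in_def partitions_of_def)
qed

lemma part_gf_nth_0 [simp]: "part_gf A $ 0 = 1"
  by (simp add: part_gf_def)

lemma partitions_in_cong:
  assumes "\<And>a. 0 < a \<Longrightarrow> a \<le> n \<Longrightarrow> a \<in> A \<longleftrightarrow> a \<in> B"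
  shows "partitions_in A n = partitions_in B n"
  using assms partition_part_bounds unfolding partitions_in_def by blast

lemma part_gf_nth_cong:
  assumes "\<And>a. 0 < a \<Longrightarrow> a \<le> n \<Longrightarrow> a \<in> A \<longleftrightarrow> a \<in> B"
  shows "part_gf A $ n = part_gf B $ n"
  using partitions_in_cong[OF assms] by (simp add: part_gf_def)

lemma part_gf_empty [simp]: "part_gf {} = (1 :: 'a::field fps)"
proof (rule fps_ext)
  fix n
  have "partitions_in {} n = (if n = 0 then {{#}} else {})"
    by (auto simp: partitions_in_def partitions_of_def)
  then show "part_gf {} $ n = (1 :: 'a fps) $ n"
    by (simp add: part_gf_def)
qed

lemma fps_X_power_dvd_part_gf_diff:
  assumes "\<And>a. 0 < a \<Longrightarrow> a < n \<Longrightarrow> a \<in> A \<longleftrightarrow> a \<in> B"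
  shows "fps_X ^ n dvd part_gf A - part_gf B"
  using assms by (auto simp: fps_X_power_dvd_iff intro!: part_gf_nth_cong)

lemma fps_X_power_dvd_part_gf_minus_1:
  assumes "\<And>a. 0 < a \<Longrightarrow> a \<in> A \<Longrightarrow> n \<le> a"
  shows "fps_X ^ n dvd part_gf A - (1 :: 'a::field fps)"
proof -
  have "fps_X ^ n dvd part_gf A - (part_gf {} :: 'a fps)"
    by (rule fps_X_power_dvd_part_gf_diff) (use assms not_le in auto)
  then show ?thesis
    by simp
qed

text \<open>A partition either avoids \<open>a\<close> or contains it and can lose one copy, so P =
  \<open>part_gf A\<close> + X^a P for P = \<open>part_gf (insert a A)\<close>.\<close>

lemma part_gf_insert:
  assumes "0 < a" "a \<notin> A"
  shows "(1 - fps_X ^ a) * part_gf (insert a A) = part_gf A"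
proof (rule fps_ext)
  fix n
  have "partitions_in (insert a A) n =
      partitions_in A n \<union> {p \<in> partitions_in (insert a A) n. a \<in># p}"
    by (auto simp: partitions_in_def)
  moreover have "partitions_in A n \<inter> {p \<in> partitions_in (insert a A) n. a \<in># p} = {}"
    using assms by (auto simp: partitions_in_def)
  ultimately have "card (partitions_in (insert a A) n) =
      card (partitions_in A n) + card {p \<in> partitions_in (insert a A) n. a \<in># p}"
    by (metis (no_types, lifting) card_Un_disjoint finite_Un finite_partitions_in)
  also have "card {p \<in> partitions_in (insert a A) n. a \<in># p} =
      (if a \<le> n then card (partitions_in (insert a A) (n - a)) else 0)"
    using assms by (simp add: partitions_in_containing card_image inj_on_def)
  finally show "((1 - fps_X ^ a) * part_gf (insert a A)) $ n = part_gf A $ n"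
    by (simp add: part_gf_def left_diff_distrib fps_X_power_mult_nth)
qed

lemma one_minus_X_power_neq_0:
  assumes "0 < a"
  shows "1 - fps_X ^ a \<noteq> (0::'a::field fps)"
  using assms by (auto simp: fps_eq_iff intro!: exI[of _ 0])

lemma part_gf_Un_finite:
  assumes "finite A" "A \<inter> B = {}"
  shows "part_gf (A \<union> B) = (part_gf A * part_gf B :: 'a::field fps)"
  using assms
proof (induction A rule: finite_induct)
  case (insert a A)
  show ?case
  proof (cases "a = 0")
    case True
    then have "part_gf (insert a C) = (part_gf C :: 'a fps)" for C
      by (intro fps_ext part_gf_nth_cong) auto
    then show ?thesis
      using insert by simp
  next
    case False
    then have "(1 - fps_X ^ a) * part_gf (insert a (A \<union> B)) =
        (1 - fps_X ^ a) * part_gf (insert a A) * (part_gf B :: 'a fps)"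
      using insert by (simp add: part_gf_insert)
    then show ?thesis
      using one_minus_X_power_neq_0[of a, where ?'a = 'a] False by (simp add: mult.assoc)
  qed
qed simp

text \<open>Only parts up to n matter at degree n. This reduces the claim to finite
  \<open>A\<close>, where the factors 1 - X^a cancel one at a time.\<close>

lemma part_gf_Un:
  assumes "A \<inter> B = {}"
  shows "part_gf (A \<union> B) = (part_gf A * part_gf B :: 'a::field fps)"
proof (rule fps_ext)
  fix n
  have "part_gf (A \<union> B) $ n = (part_gf ((A \<inter> {..n}) \<union> B) $ n :: 'a)"
    by (rule part_gf_nth_cong) auto
  also have "part_gf ((A \<inter> {..n}) \<union> B) = (part_gf (A \<inter> {..n}) * part_gf B :: 'a fps)"
    by (rule part_gf_Un_finite) (use assms in auto)
  also have "\<dots> $ n = (part_gf A * part_gf B) $ n"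
    unfolding fps_mult_nth by (intro sum.cong arg_cong2[where f = "(*)"] part_gf_nth_cong) auto
  finally show "part_gf (A \<union> B) $ n = (part_gf A * part_gf B :: 'a fps) $ n" .
qed

text \<open>With W the series of total multiplicities of \<open>a\<close> and P =
  \<open>part_gf A\<close>, removal of one copy of \<open>a\<close> gives W = X^a (P + W).\<close>

lemma count_gf:
  assumes "a \<in> A" "0 < a"
  shows "(1 - fps_X ^ a) * Abs_fps (\<lambda>n. of_nat (\<Sum>p\<in>partitions_in A n. count p a)) =
    (fps_X ^ a * part_gf A :: 'a::field fps)"
proof (rule fps_ext)
  fix n
  let ?W = "\<lambda>n. \<Sum>p\<in>partitions_in A n. count p a"
  have "?W n = (if a \<le> n then card (partitions_in A (n - a)) + ?W (n - a) else 0)"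
    using sum_partitions_in_count[OF assms, of n] by (simp add: sum_Suc)
  then have "of_nat (?W n) =
      (if a \<le> n then of_nat (card (partitions_in A (n - a))) + of_nat (?W (n - a)) else 0 :: 'a)"
    by (metis of_nat_0 of_nat_add)
  then show "((1 - fps_X ^ a) * Abs_fps (\<lambda>n. of_nat (?W n))) $ n =
      (fps_X ^ a * part_gf A :: 'a fps) $ n"
    by (simp add: part_gf_def left_diff_distrib fps_X_power_mult_nth del: of_nat_sum)
qed

lemma sum_count_smallest_part:
  assumes "\<And>s. s \<in> B s" "\<And>s x. x \<in> B s \<Longrightarrow> s \<le> x"
  shows "(\<Sum>p\<in>{p \<in> partitions_of n. set_mset p \<subseteq> B (smallest_part p)}. count p (smallest_part p)) =
    (\<Sum>s\<in>{1..n}. \<Sum>p\<in>partitions_in (B s) n. count p s)"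
proof -
  let ?Q = "{p \<in> partitions_of n. set_mset p \<subseteq> B (smallest_part p)}"
  have *: "smallest_part p = s" if "s \<in># p" "set_mset p \<subseteq> B s" for p s
    unfolding smallest_part_def using that assms(2) by (intro Min_eqI) auto
  have "(\<Sum>s\<in>{1..n}. \<Sum>p\<in>partitions_in (B s) n. count p s) =
      (\<Sum>s\<in>{1..n}. \<Sum>p\<in>partitions_of n. if set_mset p \<subseteq> B s then count p s else 0)"
    by (simp add: partitions_in_def sum.inter_filter finite_partitions_of)
  also have "\<dots> = (\<Sum>p\<in>partitions_of n. \<Sum>s\<in>{1..n}. if set_mset p \<subseteq> B s then count p s else 0)"
    by (rule sum.swap)
  also have "\<dots> = (\<Sum>p\<in>partitions_of n.
      if set_mset p \<subseteq> B (smallest_part p) then count p (smallest_part p) else 0)"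
  proof (rule sum.cong[OF refl])
    fix p assume p: "p \<in> partitions_of n"
    have "(\<Sum>s\<in>{1..n}. if set_mset p \<subseteq> B s then count p s else 0) =
      (\<Sum>s\<in>{1..n}. if s = smallest_part p then
        if set_mset p \<subseteq> B (smallest_part p) then count p (smallest_part p) else 0 else 0)"
      by (rule sum.cong) (use * in \<open>auto simp: not_in_iff[symmetric] count_eq_zero_iff\<close>)
    also have "\<dots> = (if set_mset p \<subseteq> B (smallest_part p) then count p (smallest_part p) else 0)"
    proof (cases "smallest_part p \<in># p")
      case True
      then show ?thesis
        using partition_part_bounds[OF p True] by (auto simp: sum.delta)
    next
      \<comment> \<open>This is the empty partition, where \<open>Min\<close> is unspecified; both
        sides are 0.\<close>
      case False
      then show ?thesis
        by (simp add: not_in_iff)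
    qed
    finally show "(\<Sum>s\<in>{1..n}. if set_mset p \<subseteq> B s then count p s else 0) =
      (if set_mset p \<subseteq> B (smallest_part p) then count p (smallest_part p) else 0)" .
  qed
  also have "\<dots> = (\<Sum>p\<in>?Q. count p (smallest_part p))"
    by (simp add: sum.inter_filter finite_partitions_of)
  finally show ?thesis ..
qed

subsection \<open>The q-binomial theorem\<close>

lemma fps_X_power_dvd_mult_X_power: "n \<le> k \<Longrightarrow> fps_X ^ n dvd f * (fps_X ^ k :: 'a::comm_ring_1 fps)"
  by (intro dvd_mult le_imp_power_dvd)

text \<open>With q = X^b and z = X^a, the recurrences encode \<open>c j\<close> = (e; q)_j / (q;
  q)_j and \<open>g i\<close> = (e z q^i; q)_inf / (z q^i; q)_inf. The series in z q^i satisfies the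
  same functional equation as \<open>g i\<close>, and both tend to 1, so they agree by
  \<open>fps_eq_0_if_recurrence\<close>.\<close>

lemma fps_series_q_binomial:
  fixes c g :: "nat \<Rightarrow> 'a::field fps"
  assumes "0 < a" and c0: "c 0 = 1"
    and c: "\<And>j. (1 - fps_X ^ (b * Suc j)) * c (Suc j) = (1 - e * fps_X ^ (b * j)) * c j"
    and "0 < b"
    and g: "\<And>i. (1 - fps_X ^ (a + b * i)) * g i = (1 - e * fps_X ^ (a + b * i)) * g (Suc i)"
    and g1: "\<And>i. fps_X ^ i dvd g i - 1"
  shows "fps_series (\<lambda>j. c j * fps_X ^ (a * j)) = g 0"
proof -
  define f where "f i = fps_series (\<lambda>j. c j * fps_X ^ ((a + b * i) * j))" for i
  have le: "j \<le> (a + b * i) * j" for i j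
    using \<open>0 < a\<close> by (cases a) auto
  have f_Suc: "f i = 1 + fps_series (\<lambda>j. c (Suc j) * fps_X ^ ((a + b * i) * Suc j))" for i
  proof -
    have "fps_X ^ j dvd c j * fps_X ^ ((a + b * i) * j)" for j
      by (rule fps_X_power_dvd_mult_X_power) (rule le)
    from fps_series_Suc[OF this] show ?thesis
      by (simp only: f_def mult_0_right power_0 c0 mult_1_right)
  qed
  have f_rec: "(1 - fps_X ^ (a + b * i)) * f i = (1 - e * fps_X ^ (a + b * i)) * f (Suc i)" for i
  proof -
    define z where "z = (fps_X ^ (a + b * i) :: 'a fps)"
    have pow: "fps_X ^ ((a + b * i) * j) = z ^ j" for j
      by (simp only: z_def power_mult)
    have pow': "fps_X ^ ((a + b * Suc i) * j) = fps_X ^ (b * j) * z ^ j" for j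
      unfolding pow[symmetric] power_add[symmetric] by (rule arg_cong[where f = "power fps_X"]) (simp add: algebra_simps)
    have fi: "f i = fps_series (\<lambda>j. c j * z ^ j)"
      by (simp only: f_def pow)
    have f': "f (Suc i) = fps_series (\<lambda>j. fps_X ^ (b * j) * c j * z ^ j)"
      unfolding f_def pow' by (simp only: mult_ac)
    have dvd: "fps_X ^ j dvd x * z ^ j" for x j
      unfolding pow[symmetric] by (rule fps_X_power_dvd_mult_X_power) (rule le)
    have "f i - f (Suc i) = fps_series (\<lambda>j. (1 - fps_X ^ (b * j)) * c j * z ^ j)"
      unfolding fi f' fps_series_diff[symmetric] by (simp only: left_diff_distrib mult_1_left)
    \<comment> \<open>The term j = 0 vanishes because of its factor 1 - X^0; after the index shift
      the recurrence of \<open>c\<close> applies.\<close>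
    also have "\<dots> = fps_series (\<lambda>j. (1 - fps_X ^ (b * Suc j)) * c (Suc j) * z ^ Suc j)"
      by (subst fps_series_Suc[OF dvd]) simp
    also have "\<dots> = fps_series (\<lambda>j. z * (c j * z ^ j) - e * z * (fps_X ^ (b * j) * c j * z ^ j))"
      unfolding c power_Suc by (intro arg_cong[where f = fps_series] ext) algebra
    also have "\<dots> = z * f i - e * z * f (Suc i)"
      unfolding fi f' fps_series_diff fps_series_mult_left[OF dvd] ..
    finally show ?thesis
      unfolding z_def[symmetric] by algebra
  qed
  have small: "fps_X ^ i dvd f i - g i" for i
  proof -
    have "fps_X ^ i dvd f i - 1"
      unfolding f_Suc add_diff_cancel_left'
    proof (intro fps_X_power_dvd_series fps_X_power_dvd_mult_X_power)
      show "i \<le> (a + b * i) * Suc j" for j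
        using \<open>0 < b\<close> by (cases b) auto
    qed
    moreover have "f i - g i = (f i - 1) - (g i - 1)"
      by simp
    ultimately show ?thesis
      using dvd_diff[OF _ g1[of i]] by metis
  qed
  have "f 0 - g 0 = 0"
  proof (rule fps_eq_0_if_recurrence[where d = "\<lambda>i. f i - g i"])
    show "(1 - fps_X ^ (a + b * i)) * (f i - g i) =
        (1 - e * fps_X ^ (a + b * i)) * (f (Suc i) - g (Suc i))" for i
      unfolding right_diff_distrib f_rec g ..
  qed (use small \<open>0 < a\<close> in simp_all)
  then show ?thesis
    by (simp add: f_def)
qed

subsection \<open>Lambert series\<close>

text \<open>For c > 0 this is X^c / (1 - X^c). The condition 0 < n removes the constant term, since
  every c divides 0.\<close>

definition lambert_term :: "nat \<Rightarrow> 'a::field fps" where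
  "lambert_term c = Abs_fps (\<lambda>n. of_bool (0 < n \<and> c dvd n))"

lemma lambert_term:
  assumes "0 < c"
  shows "(1 - fps_X ^ c) * lambert_term c = fps_X ^ c"
proof (rule fps_ext)
  fix n
  show "((1 - fps_X ^ c) * lambert_term c) $ n = (fps_X ^ c :: 'a fps) $ n"
    using assms
    by (auto simp: lambert_term_def left_diff_distrib fps_X_power_mult_nth dvd_minus_self
        dest: dvd_imp_le)
qed

definition progression :: "nat \<Rightarrow> nat \<Rightarrow> nat set" where
  "progression a b = range (\<lambda>i. a + b * i)"

lemma progression_rec: "progression a b = insert a (progression (a + b) b)"
proof -
  have "range f = insert (f 0) (range (\<lambda>i. f (Suc i)))" for f :: "nat \<Rightarrow> nat"
    by (auto simp: image_iff) (metis not0_implies_Suc)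
  from this[of "\<lambda>i. a + b * i"] show ?thesis
    by (simp add: progression_def add.assoc)
qed

lemma progression_ge: "x \<in> progression a b \<Longrightarrow> a \<le> x"
  by (auto simp: progression_def)

lemma part_gf_progression_rec:
  assumes "0 < a" "0 < b"
  shows "(1 - fps_X ^ a) * part_gf (progression a b) = part_gf (progression (a + b) b)"
  unfolding progression_rec[of a b]
  by (rule part_gf_insert) (use assms progression_ge[of a "a + b" b] in auto)

text \<open>In q-notation with p = X^2, the m-th term is (p^(m+1); p)_inf / (X^c p^m; p)_inf - 1.
  Subtracting 1 makes the terms tend to 0. The cases c = 1 and c = 2 are the ones wanted; general
  \<open>c\<close> allows the recursion from c to c + 2.\<close>

definition lambert_sum :: "nat \<Rightarrow> 'a::field fps" where
  "lambert_sum c = fps_series (\<lambda>m.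
     part_gf (progression (c + 2 * m) 2) * inverse (part_gf (progression (2 + 2 * m) 2)) - 1)"

lemma fps_X_power_dvd_progression:
  assumes "n \<le> a"
  shows "fps_X ^ n dvd part_gf (progression a b) - (1 :: 'a::field fps)"
    and "fps_X ^ n dvd inverse (part_gf (progression a b)) - (1 :: 'a fps)"
proof -
  show "fps_X ^ n dvd part_gf (progression a b) - (1 :: 'a::field fps)"
    by (rule fps_X_power_dvd_part_gf_minus_1) (use assms progression_ge le_trans in blast)
  then show "fps_X ^ n dvd inverse (part_gf (progression a b)) - (1 :: 'a fps)"
    by (rule fps_X_power_dvd_inverse_minus_1[rotated]) simp
qed

lemma part_gf_times_inverse [simp]: "part_gf A * inverse (part_gf A) = (1 :: 'a::field fps)"
  by (rule inverse_mult_eq_1') simp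

text \<open>With \<open>p = X\<^sup>2\<close> and \<open>z = X\<^sup>c\<close>, the difference of the \<open>m\<close>-th terms is, up to the factor
  \<open>z / (1 - z)\<close>, the increment of \<open>(p\<^sup>m; p)\<^sub>\<infinity> / (z p\<^sup>m; p)\<^sub>\<infinity>\<close>.\<close>

lemma lambert_sum_rec:
  assumes "0 < c"
  shows "lambert_sum c - lambert_sum (c + 2) = (lambert_term c :: 'a::field fps)"
proof -
  define A :: "nat \<Rightarrow> nat \<Rightarrow> 'a fps" where "A c m = part_gf (progression (c + 2 * m) 2)" for c m
  define T where "T c m = A c m * inverse (A 2 m)" for c m
  define t where "t m = (1 - fps_X ^ (2 * m)) * T c m" for m
  have A_rec: "(1 - fps_X ^ (c + 2 * m)) * A c m = A (c + 2) m" if "0 < c" for c m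
    using part_gf_progression_rec[of "c + 2 * m" 2] that by (simp add: A_def add_ac)
  have A_shift: "A (c + 2) m = A c (Suc m)" for c m
    by (simp add: A_def add_ac)
  have T1: "fps_X ^ m dvd T c m - 1" for c m
    unfolding T_def A_def
    by (intro fps_X_power_dvd_mult_minus_1 fps_X_power_dvd_progression) simp_all
  \<comment> \<open>Passing to m + 1 moves both progressions up by 2. The factor 1 - X^(2 m + 2) of
    \<open>t\<close> moves the denominator back, so that in effect only c changes.\<close>
  have t_Suc: "t (Suc m) = T (c + 2) m" for m
  proof -
    have "A 2 (Suc m) = (1 - fps_X ^ (2 * Suc m)) * A 2 m"
      using A_rec[of 2 m] A_shift[of 2 m] by simp
    then have "inverse (A 2 m) = (1 - fps_X ^ (2 * Suc m)) * inverse (A 2 (Suc m))"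
      using fps_inverse_mult[of "1 - fps_X ^ (2 * Suc m)" "A 2 m"]
        inverse_mult_eq_1'[of "1 - fps_X ^ (2 * Suc m) :: 'a fps"]
      by (simp flip: mult.assoc)
    then show ?thesis
      by (simp only: t_def T_def A_shift mult_ac)
  qed
  have T_diff: "T c m - T (c + 2) m = fps_X ^ (c + 2 * m) * T c m" for m
    unfolding T_def A_rec[OF assms, symmetric] by algebra
  have t_diff: "t (Suc m) - t m = fps_X ^ (2 * m) * (1 - fps_X ^ c) * T c m" for m
  proof -
    have "T (c + 2) m = T c m - fps_X ^ c * fps_X ^ (2 * m) * T c m"
      using T_diff[of m] unfolding power_add by (metis diff_eq_eq add_diff_cancel_left' diff_add_cancel)
    then show ?thesis
      unfolding t_Suc t_def[of m] by (simp only: left_diff_distrib right_diff_distrib mult_1_left mult_1_right mult_ac) simp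
  qed
  have t1: "fps_X ^ m dvd t m - 1" for m
  proof -
    have "fps_X ^ m dvd - 1 * (fps_X ^ (2 * m) :: 'a fps)"
      by (rule fps_X_power_dvd_mult_X_power) simp
    then have "fps_X ^ m dvd (1 - fps_X ^ (2 * m)) - (1 :: 'a fps)"
      by simp
    then show ?thesis
      unfolding t_def by (intro fps_X_power_dvd_mult_minus_1 T1)
  qed
  have dvd: "fps_X ^ m dvd T c m - T (c + 2) m" for m
    using dvd_diff[OF T1[of m c] T1[of m "c + 2"]] by simp
  have "lambert_sum c - lambert_sum (c + 2) = fps_series (\<lambda>m. T c m - T (c + 2) m)"
    unfolding lambert_sum_def fps_series_diff[symmetric] by (simp add: T_def A_def)
  then have "(1 - fps_X ^ c) * (lambert_sum c - lambert_sum (c + 2)) =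
      fps_series (\<lambda>m. (1 - fps_X ^ c) * (T c m - T (c + 2) m))"
    by (simp only: fps_series_mult_left[OF dvd])
  also have "\<dots> = fps_series (\<lambda>m. fps_X ^ c * (t (Suc m) - t m))"
    by (simp only: T_diff t_diff power_add mult_ac)
  also have "\<dots> = fps_X ^ c * fps_series (\<lambda>m. t (Suc m) - t m)"
  proof (rule fps_series_mult_left)
    show "fps_X ^ m dvd t (Suc m) - t m" for m
      unfolding t_diff by (intro dvd_mult2 le_imp_power_dvd) simp
  qed
  \<comment> \<open>\<open>t\<close> tends to 1, and \<open>t 0\<close> is 0 because of its factor 1
    - X^0.\<close>
  also have "fps_series (\<lambda>m. t (Suc m) - t m) = 1"
    using fps_series_telescope[of t 1, OF t1] by (simp add: t_def)
  finally show ?thesis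
    using lambert_term[OF assms, where ?'a = 'a] one_minus_X_power_neq_0[OF assms, where ?'a = 'a]
    by (metis mult_cancel_left mult.right_neutral)
qed

lemma fps_X_power_dvd_lambert_term: "n \<le> c \<Longrightarrow> fps_X ^ n dvd lambert_term c"
  by (auto simp: fps_X_power_dvd_iff lambert_term_def dest: dvd_imp_le)

text \<open>Iterating \<open>lambert_sum_rec\<close> adds up Lambert terms while c grows. In the
  limit the numerators become 1, which leaves the first series, independent of
  \<open>c\<close>.\<close>

lemma lambert_sum_eq:
  assumes "0 < c"
  shows "lambert_sum c = fps_series (\<lambda>m. inverse (part_gf (progression (2 + 2 * m) 2)) - 1) +
    fps_series (\<lambda>i. lambert_term (c + 2 * i) :: 'a::field fps)"
    (is "_ = ?y + ?L")
proof -
  have sum: "lambert_sum c - lambert_sum (c + 2 * n) = (\<Sum>i<n. lambert_term (c + 2 * i) :: 'a fps)" for n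
  proof (induction n)
    case (Suc n)
    then show ?case
      using lambert_sum_rec[of "c + 2 * n", where ?'a = 'a] assms by (simp add: algebra_simps)
  qed simp
  have lim: "fps_X ^ n dvd lambert_sum n - ?y" for n
    unfolding lambert_sum_def fps_series_diff[symmetric]
  proof (rule fps_X_power_dvd_series)
    fix m
    let ?a = "part_gf (progression (n + 2 * m) 2) :: 'a fps"
      and ?r = "inverse (part_gf (progression (2 + 2 * m) 2)) :: 'a fps"
    have "fps_X ^ n dvd (?a - 1) * ?r"
      by (intro dvd_mult2 fps_X_power_dvd_progression) simp
    then show "fps_X ^ n dvd ?a * ?r - 1 - (?r - 1)"
      by (simp add: algebra_simps)
  qed
  show ?thesis
  proof (rule fps_ext)
    fix k
    \<comment> \<open>At degree k, k + 1 iterations suffice, as c + 2 (k + 1) exceeds k.\<close>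
    have "lambert_sum (c + 2 * Suc k) $ k = ?y $ k"
      using lim[of "c + 2 * Suc k"] unfolding fps_X_power_dvd_iff by simp
    moreover have "(\<Sum>i<Suc k. lambert_term (c + 2 * i) :: 'a fps) $ k = ?L $ k"
      by (simp add: fps_sum_nth fps_series_def lessThan_Suc_atMost)
    ultimately show "lambert_sum c $ k = (?y + ?L) $ k"
      using arg_cong[OF sum[of "Suc k"], of "\<lambda>f. f $ k"] by (simp add: algebra_simps)
  qed
qed

subsection \<open>Characteristic two\<close>

lemma bit_add_self: "x + x = (0::bit)"
  using bit_2_eq_0 by (metis mult_2 mult_zero_left)

lemma bit_fps_add_self: "f + f = (0::bit fps)"
  by (rule fps_ext) (simp only: fps_add_nth bit_add_self fps_zero_nth)

lemma bit_fps_square_diff: "(f - g)\<^sup>2 = f\<^sup>2 - (g\<^sup>2 :: bit fps)"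
proof -
  have "(f - g)\<^sup>2 = f\<^sup>2 - g\<^sup>2 - (g * (f - g) + g * (f - g))"
    by (simp add: power2_eq_square algebra_simps)
  then show ?thesis
    by (simp only: bit_fps_add_self diff_0_right)
qed

text \<open>In the convolution the terms at i and n - i cancel in pairs. Only the midpoint 2 i = n
  survives, where x * x = x.\<close>

lemma bit_fps_square_nth: "(f\<^sup>2 :: bit fps) $ n = (if even n then f $ (n div 2) else 0)"
proof -
  define g where "g i = f $ i * f $ (n - i)" for i
  let ?A = "{i. i \<le> n \<and> n < 2 * i}" and ?B = "{i. 2 * i < n}" and ?C = "{i. 2 * i = n}"
  have fin: "finite ?A" "finite ?B" "finite ?C"
    by (rule finite_subset[of _ "{..n}"]; auto)+
  have "{0..n} = ?A \<union> ?B \<union> ?C"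
    by auto
  then have "sum g {0..n} = sum g (?A \<union> ?B \<union> ?C)"
    by (rule arg_cong)
  also have "\<dots> = sum g (?A \<union> ?B) + sum g ?C"
    by (rule sum.union_disjoint) (use fin in auto)
  also have "sum g (?A \<union> ?B) = sum g ?A + sum g ?B"
    by (rule sum.union_disjoint) (use fin in auto)
  also have "sum g ?A = sum g ?B"
    by (rule sum.reindex_bij_witness[of _ "\<lambda>i. n - i" "\<lambda>i. n - i"])
      (auto simp: g_def mult.commute)
  finally have "sum g {0..n} = sum g {i. 2 * i = n}"
    by (simp only: bit_add_self add_0_left)
  moreover have "{i. 2 * i = n} = (if even n then {n div 2} else {})"
    by auto
  moreover have "x * x = x" for x :: bit
    by (cases x) simp_all
  ultimately show ?thesis
    by (auto simp: power2_eq_square fps_mult_nth g_def elim!: evenE simp del: mult_bit_eq_and)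
qed

lemma bit_fps_series_square:
  assumes "\<And>n. fps_X ^ n dvd f n"
  shows "(fps_series f)\<^sup>2 = fps_series (\<lambda>n. (f n)\<^sup>2 :: bit fps)"
proof (rule fps_ext)
  fix k
  have "fps_series f $ (k div 2) = (\<Sum>n\<le>k. f n $ (k div 2))"
    by (rule fps_series_nth[OF assms]) simp
  then show "(fps_series f)\<^sup>2 $ k = fps_series (\<lambda>n. (f n)\<^sup>2) $ k"
    by (simp add: bit_fps_square_nth fps_series_def[of "\<lambda>n. (f n)\<^sup>2"])
qed

text \<open>In characteristic two (1 - X^a)^2 = 1 - X^(2 a), so squaring turns the factor of a part
  a into that of 2 a.\<close>

lemma part_gf_square_finite:
  assumes "finite A"
  shows "(part_gf A)\<^sup>2 = (part_gf ((*) 2 ` A) :: bit fps)"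
  using assms
proof (induction A rule: finite_induct)
  case (insert a A)
  show ?case
  proof (cases "a = 0")
    case True
    then have "part_gf (insert a C) = (part_gf C :: bit fps)" for C
      by (intro fps_ext part_gf_nth_cong) auto
    then show ?thesis
      using insert True by simp
  next
    case False
    then have "(1 - fps_X ^ (2 * a)) * (part_gf (insert a A))\<^sup>2 =
        ((1 - fps_X ^ a) * part_gf (insert a A) :: bit fps)\<^sup>2"
      by (simp only: power_mult_distrib bit_fps_square_diff one_power2 mult.commute[of 2] power_mult)
    also have "(1 - fps_X ^ a) * part_gf (insert a A) = (part_gf A :: bit fps)"
      using part_gf_insert insert False by blast
    also have "(part_gf A)\<^sup>2 = (part_gf ((*) 2 ` A) :: bit fps)"
      by (rule insert)
    also have "\<dots> = (1 - fps_X ^ (2 * a)) * part_gf (insert (2 * a) ((*) 2 ` A))"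
      by (rule part_gf_insert[symmetric]) (use False insert in auto)
    finally show ?thesis
      using one_minus_X_power_neq_0[of "2 * a", where ?'a = bit] False by simp
  qed
qed simp

lemma part_gf_square: "(part_gf A)\<^sup>2 = (part_gf ((*) 2 ` A) :: bit fps)"
proof (rule fps_ext)
  fix n
  have "(part_gf A)\<^sup>2 $ n = ((part_gf (A \<inter> {..n}))\<^sup>2 :: bit fps) $ n"
    unfolding power2_eq_square fps_mult_nth
    by (intro sum.cong arg_cong2[where f = "(*)"] part_gf_nth_cong) auto
  also have "\<dots> = part_gf ((*) 2 ` (A \<inter> {..n})) $ n"
    by (subst part_gf_square_finite) simp_all
  also have "\<dots> = part_gf ((*) 2 ` A) $ n"
    by (rule part_gf_nth_cong) auto
  finally show "(part_gf A)\<^sup>2 $ n = (part_gf ((*) 2 ` A) :: bit fps) $ n" .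
qed

section \<open>Partitions into parts greater than m, modulo 2\<close>

definition tail_gf :: "nat \<Rightarrow> bit fps" where
  "tail_gf m = part_gf {m<..}"

definition tail_inv :: "nat \<Rightarrow> bit fps" where
  "tail_inv m = inverse (tail_gf m)"

lemma tail_gf_nth_0 [simp]: "tail_gf m $ 0 = 1"
  by (simp add: tail_gf_def)

lemma tail_gf_inv: "tail_gf m * tail_inv m = 1"
  by (simp add: tail_gf_def tail_inv_def)

lemma tail_gf_rec: "(1 - fps_X ^ Suc m) * tail_gf m = tail_gf (Suc m)"
proof -
  have "{m<..} = insert (Suc m) {Suc m<..}"
    by auto
  then show ?thesis
    unfolding tail_gf_def by (simp only:) (rule part_gf_insert, auto)
qed

lemma tail_inv_rec: "(1 - fps_X ^ Suc m) * tail_inv (Suc m) = tail_inv m"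
proof -
  have "(1 - fps_X ^ Suc m) * tail_inv (Suc m) * (tail_gf m * tail_inv m) =
      (1 - fps_X ^ Suc m) * tail_gf m * tail_inv (Suc m) * tail_inv m"
    by (simp only: mult_ac)
  then show ?thesis
    by (simp only: tail_gf_inv tail_gf_rec mult_1_left mult_1_right)
qed

lemma one_minus_X_power_square: "(1 - fps_X ^ n)\<^sup>2 = (1 - fps_X ^ (2 * n) :: bit fps)"
  by (simp only: bit_fps_square_diff one_power2 mult.commute[of 2] power_mult)

lemma tail_gf_square_rec: "(1 - fps_X ^ (2 * Suc m)) * (tail_gf m)\<^sup>2 = (tail_gf (Suc m))\<^sup>2"
  by (simp only: tail_gf_rec[of m, symmetric] power_mult_distrib one_minus_X_power_square)

lemma tail_inv_square_rec: "(1 - fps_X ^ (2 * Suc m)) * (tail_inv (Suc m))\<^sup>2 = (tail_inv m)\<^sup>2"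
  by (simp only: tail_inv_rec[of m, symmetric] power_mult_distrib one_minus_X_power_square)

lemma fps_X_power_dvd_tail:
  assumes "n \<le> Suc m"
  shows "fps_X ^ n dvd tail_gf m - 1" "fps_X ^ n dvd tail_inv m - 1"
proof -
  show "fps_X ^ n dvd tail_gf m - 1"
    unfolding tail_gf_def by (rule fps_X_power_dvd_part_gf_minus_1) (use assms in auto)
  then show "fps_X ^ n dvd tail_inv m - 1"
    unfolding tail_inv_def by (rule fps_X_power_dvd_inverse_minus_1[rotated]) simp
qed

lemma fps_X_power_dvd_square_minus_1:
  fixes f :: "'a::comm_ring_1 fps"
  shows "fps_X ^ n dvd f - 1 \<Longrightarrow> fps_X ^ n dvd f\<^sup>2 - 1"
  unfolding power2_eq_square by (rule fps_X_power_dvd_mult_minus_1)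

text \<open>Euler's expansion of 1 / (z; X)_inf at z = X^(a+1), the case e = 0 of the q-binomial
  theorem: \<open>tail_gf 0 * tail_inv j\<close> is 1 / (X; X)_j.\<close>

lemma tail_gf_expansion:
  "fps_series (\<lambda>j. tail_gf 0 * tail_inv j * fps_X ^ (Suc a * j)) = tail_gf a"
proof -
  have "fps_series (\<lambda>j. tail_gf 0 * tail_inv j * fps_X ^ (Suc a * j)) = tail_gf (a + 0)"
  proof (rule fps_series_q_binomial[where b = 1 and e = 0 and g = "\<lambda>i. tail_gf (a + i)"])
    show "(1 - fps_X ^ (1 * Suc j)) * (tail_gf 0 * tail_inv (Suc j)) =
        (1 - 0 * fps_X ^ (1 * j)) * (tail_gf 0 * tail_inv j)" for j
      unfolding tail_inv_rec[of j, symmetric] by (simp only: mult_1_left mult_zero_left diff_0_right mult_ac)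
    show "(1 - fps_X ^ (Suc a + 1 * i)) * tail_gf (a + i) =
        (1 - 0 * fps_X ^ (Suc a + 1 * i)) * tail_gf (a + Suc i)" for i
      using tail_gf_rec[of "a + i"]
      by (simp only: mult_1_left mult_zero_left diff_0_right add_Suc add_Suc_right)
    show "fps_X ^ i dvd tail_gf (a + i) - 1" for i
      by (rule fps_X_power_dvd_tail) simp
  qed (simp_all add: tail_gf_inv)
  then show ?thesis
    by simp
qed

lemma tail_gf_square_expansion:
  "fps_series (\<lambda>j. (tail_gf 0)\<^sup>2 * (tail_inv j)\<^sup>2 * fps_X ^ (2 * Suc a * j)) = (tail_gf a)\<^sup>2"
proof -
  have "fps_X ^ j dvd tail_gf 0 * tail_inv j * fps_X ^ (Suc a * j)" for j
    by (rule fps_X_power_dvd_mult_X_power) simp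
  from bit_fps_series_square[OF this] show ?thesis
    unfolding tail_gf_expansion power_mult_distrib power_mult[symmetric]
    by (simp only: mult_ac)
qed

text \<open>Euler's expansion without its term j = 0, divided by \<open>tail_gf 0\<close>. It
  evaluates the inner sum once the summations are exchanged.\<close>

lemma tail_inv_expansion:
  "fps_series (\<lambda>n. tail_inv (Suc n) * fps_X ^ (Suc a * Suc n)) = tail_inv 0 * (tail_gf a - 1)"
proof -
  have dvd: "fps_X ^ j dvd tail_gf 0 * tail_inv j * fps_X ^ (Suc a * j)" for j
    by (rule fps_X_power_dvd_mult_X_power) simp
  have dvd': "fps_X ^ j dvd tail_inv (Suc j) * fps_X ^ (Suc a * Suc j)" for j
    by (rule fps_X_power_dvd_mult_X_power) simp
  have "tail_gf a = 1 + fps_series (\<lambda>j. tail_gf 0 * tail_inv (Suc j) * fps_X ^ (Suc a * Suc j))"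
    using fps_series_Suc[OF dvd]
    unfolding tail_gf_expansion tail_gf_inv by (simp only: mult_0_right power_0 mult_1_right)
  then have "tail_gf a - 1 = fps_series (\<lambda>j. tail_gf 0 * (tail_inv (Suc j) * fps_X ^ (Suc a * Suc j)))"
    by (metis (no_types, lifting) add_diff_cancel_left' ext mult.assoc)
  also have "\<dots> = tail_gf 0 * fps_series (\<lambda>j. tail_inv (Suc j) * fps_X ^ (Suc a * Suc j))"
    by (rule fps_series_mult_left) (rule dvd')
  finally have "tail_inv 0 * (tail_gf a - 1) =
      tail_gf 0 * tail_inv 0 * fps_series (\<lambda>j. tail_inv (Suc j) * fps_X ^ (Suc a * Suc j))"
    by (simp only: mult_ac)
  then show ?thesis
    by (simp only: tail_gf_inv mult_1_left)
qed

subsection \<open>The generating functions of spt and spt_o_plus\<close>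

text \<open>The q-binomial theorem with q = X^2, e = X and z = X^(2 n + 2). Modulo 2 the coefficient
  is (X; X)_(2j) / (X; X)_j^4 = (X; X^2)_j / (X^2; X^2)_j, and the right side is (X z; X^2)_inf /
  (z; X^2)_inf.\<close>

lemma tail_ratio_expansion:
  "fps_series (\<lambda>j. tail_gf (2 * j) * (tail_inv j ^ 2)\<^sup>2 * tail_gf 0 ^ 3 * fps_X ^ (2 * Suc n * j)) =
    (tail_gf n)\<^sup>2 * (tail_gf (Suc n))\<^sup>2 * tail_inv (2 * Suc n)"
proof -
  define e where "e j = tail_gf (2 * j) * (tail_inv j ^ 2)\<^sup>2 * tail_gf 0 ^ 3" for j
  define g where "g k = (tail_gf k)\<^sup>2 * (tail_gf (Suc k))\<^sup>2 * tail_inv (2 * Suc k)" for k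
  define u where "u k = (1 - fps_X ^ (2 * Suc k) :: bit fps)" for k
  define v where "v k = (1 - fps_X * fps_X ^ (2 * k) :: bit fps)" for k
  have gf2: "tail_gf (2 * Suc k) = u k * v k * tail_gf (2 * k)" for k
    using tail_gf_rec[of "2 * k"] tail_gf_rec[of "Suc (2 * k)"]
    by (simp add: u_def v_def mult.assoc)
  have inv2: "tail_inv (2 * k) = u k * v k * tail_inv (2 * Suc k)" for k
  proof -
    have "tail_inv (2 * k) =
        (1 - fps_X ^ Suc (2 * k)) * ((1 - fps_X ^ Suc (Suc (2 * k))) * tail_inv (Suc (Suc (2 * k))))"
      unfolding tail_inv_rec ..
    then show ?thesis
      by (simp add: u_def v_def mult_ac)
  qed
  have gf_sq: "(tail_gf (Suc k))\<^sup>2 = u k * (tail_gf k)\<^sup>2" for k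
    unfolding u_def tail_gf_square_rec ..
  have inv_sq: "(tail_inv k)\<^sup>2 = u k * (tail_inv (Suc k))\<^sup>2" for k
    unfolding u_def tail_inv_square_rec ..
  have "fps_series (\<lambda>j. e j * fps_X ^ (2 * Suc n * j)) = g (n + 0)"
  proof (rule fps_series_q_binomial[where b = 2 and e = fps_X and g = "\<lambda>i. g (n + i)"])
    have "e 0 = (tail_gf 0 * tail_inv 0) ^ 4"
      by (simp add: e_def power_mult_distrib power_numeral_reduce power2_eq_square mult_ac)
    then show "e 0 = 1"
      by (simp only: tail_gf_inv power_one)
    show "(1 - fps_X ^ (2 * Suc j)) * e (Suc j) = (1 - fps_X * fps_X ^ (2 * j)) * e j" for j
      unfolding e_def gf2 inv_sq[of j] u_def[symmetric] v_def[symmetric] power_mult_distrib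
      by (simp only: power2_eq_square mult_ac)
    show "(1 - fps_X ^ (2 * Suc n + 2 * i)) * g (n + i) =
        (1 - fps_X * fps_X ^ (2 * Suc n + 2 * i)) * g (n + Suc i)" for i
    proof -
      have "2 * Suc n + 2 * i = 2 * Suc (n + i)"
        by simp
      moreover have "u k * g k = v (Suc k) * g (Suc k)" for k
      proof -
        have "u k * g k = (tail_gf (Suc k))\<^sup>2 * (tail_gf (Suc k))\<^sup>2 *
            (u (Suc k) * v (Suc k) * tail_inv (2 * Suc (Suc k)))"
          unfolding g_def inv2[of "Suc k"] gf_sq[of k] by (simp only: mult_ac)
        also have "\<dots> = v (Suc k) * g (Suc k)"
          unfolding g_def gf_sq[of "Suc k"] by (simp only: mult_ac)
        finally show ?thesis .
      qed
      ultimately show ?thesis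
        by (simp only: u_def v_def add_Suc_right)
    qed
    show "fps_X ^ i dvd g (n + i) - 1" for i
      unfolding g_def
      by (intro fps_X_power_dvd_mult_minus_1 fps_X_power_dvd_square_minus_1 fps_X_power_dvd_tail) simp_all
  qed simp_all
  then show ?thesis
    by (simp only: e_def g_def add_0_right)
qed

text \<open>The exchange of summations shared by both generating functions, which differ only in
  \<open>c\<close>. The powers of X combine to the exponent (2 m + 1)(n + 1), so the sum over n is
  \<open>tail_inv_expansion\<close> at 2 m.\<close>

lemma tail_double_sum:
  "fps_series (\<lambda>n. fps_X ^ Suc n * tail_inv (Suc n) * fps_series (\<lambda>m. c m * fps_X ^ (2 * Suc n * m))) =
    fps_series (\<lambda>m. c m * (tail_inv 0 * (tail_gf (2 * m) - 1)))"
proof -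
  have "fps_X ^ m dvd c m * fps_X ^ (2 * Suc n * m)" for n m
    by (rule fps_X_power_dvd_mult_X_power) simp
  note inner = fps_series_mult_left[OF this, symmetric]
  have dvd: "fps_X ^ n dvd tail_inv (Suc n) * fps_X ^ (Suc (2 * m) * Suc n)" for n m
    by (rule fps_X_power_dvd_mult_X_power) simp
  have eq: "fps_X ^ Suc n * tail_inv (Suc n) * (c m * fps_X ^ (2 * Suc n * m)) =
      c m * (tail_inv (Suc n) * fps_X ^ (Suc (2 * m) * Suc n))" for n m
  proof -
    have "fps_X ^ (Suc (2 * m) * Suc n) = (fps_X ^ Suc n * fps_X ^ (2 * Suc n * m) :: bit fps)"
      unfolding power_add[symmetric] by (rule arg_cong[where f = "power fps_X"]) (simp add: algebra_simps)
    then show ?thesis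
      by (simp only: mult_ac)
  qed
  show ?thesis
    unfolding inner eq
    by (subst fps_series_swap) (simp only: fps_series_mult_left[OF dvd] tail_inv_expansion)
qed

text \<open>\<open>Z n\<close> belongs to the smallest part s = n + 1 and equals X^s / (1 - X^s)
  times \<open>part_gf (B s)\<close>, by \<open>count_gf\<close>.\<close>

lemma smallest_part_gf:
  fixes Z :: "nat \<Rightarrow> 'a::field fps"
  assumes B: "\<And>s. s \<in> B s" "\<And>s x. x \<in> B s \<Longrightarrow> s \<le> x"
    and Z: "\<And>n. (1 - fps_X ^ Suc n) * Z n = fps_X ^ Suc n * part_gf (B (Suc n))"
  shows "Abs_fps (\<lambda>n. of_nat (\<Sum>p\<in>{p \<in> partitions_of n. set_mset p \<subseteq> B (smallest_part p)}.
    count p (smallest_part p))) = fps_series Z"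
proof (rule fps_ext)
  fix k
  define W where "W s = (Abs_fps (\<lambda>n. of_nat (\<Sum>p\<in>partitions_in (B s) n. count p s)) :: 'a fps)" for s
  have W: "W (Suc n) = Z n" for n
  proof -
    have "(1 - fps_X ^ Suc n) * W (Suc n) = (1 - fps_X ^ Suc n) * Z n"
      unfolding Z W_def by (rule count_gf) (use B in auto)
    then show ?thesis
      using one_minus_X_power_neq_0[of "Suc n", where ?'a = 'a] by (simp del: power_Suc)
  qed
  \<comment> \<open>At degree k the series includes the index n = k, that is s = k + 1, just outside
    {1..k}. A partition of k has no such part.\<close>
  have "count p (Suc k) = 0" if "p \<in> partitions_in (B (Suc k)) k" for p
    using partition_part_bounds(2)[of p k "Suc k"] that
    by (auto simp: partitions_in_def not_in_iff[symmetric])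
  then have "W (Suc k) $ k = 0"
    unfolding W_def fps_nth_Abs_fps by (simp del: of_nat_sum)
  then have "fps_series Z $ k = (\<Sum>n<k. W (Suc n) $ k)"
    by (simp add: fps_series_def lessThan_Suc_atMost[symmetric] flip: W)
  also have "\<dots> = (\<Sum>s\<in>{1..k}. W s $ k)"
    by (simp add: sum.atLeast1_atMost_eq)
  also have "\<dots> = of_nat (\<Sum>s\<in>{1..k}. \<Sum>p\<in>partitions_in (B s) k. count p s)"
    by (simp add: W_def)
  also have "(\<Sum>s\<in>{1..k}. \<Sum>p\<in>partitions_in (B s) k. count p s) =
      (\<Sum>p\<in>{p \<in> partitions_of k. set_mset p \<subseteq> B (smallest_part p)}. count p (smallest_part p))"
    by (rule sum_count_smallest_part[symmetric]) (use B in auto)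
  finally show "Abs_fps (\<lambda>n. of_nat (\<Sum>p\<in>{p \<in> partitions_of n. set_mset p \<subseteq> B (smallest_part p)}.
      count p (smallest_part p))) $ k = fps_series Z $ k"
    by simp
qed

lemma smallest_part_le: "x \<in># p \<Longrightarrow> smallest_part p \<le> x"
  by (simp add: smallest_part_def)

text \<open>Smallest part s = n + 1 contributes X^s N(n) / (1 - X^s), and 1 / (1 - X^s) = N(n) /
  N(s). The resulting N(n)^2 is the factor to expand.\<close>

lemma spt_gf:
  "Abs_fps (\<lambda>n. of_nat (spt n)) =
    fps_series (\<lambda>m. (tail_gf 0)\<^sup>2 * (tail_inv m)\<^sup>2 * (tail_inv 0 * (tail_gf (2 * m) - 1)))"
proof -
  have "partitions_of n = {p \<in> partitions_of n. set_mset p \<subseteq> {smallest_part p..}}" for n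
    using smallest_part_le by auto
  then have "Abs_fps (\<lambda>n. of_nat (spt n)) = (Abs_fps (\<lambda>n. of_nat (\<Sum>p\<in>{p \<in> partitions_of n.
      set_mset p \<subseteq> {smallest_part p..}}. count p (smallest_part p))) :: bit fps)"
    unfolding spt_def by metis
  also have "\<dots> = fps_series (\<lambda>n. fps_X ^ Suc n * tail_inv (Suc n) * (tail_gf n)\<^sup>2)"
  proof (rule smallest_part_gf)
    show "(1 - fps_X ^ Suc n) * (fps_X ^ Suc n * tail_inv (Suc n) * (tail_gf n)\<^sup>2) =
        fps_X ^ Suc n * part_gf {Suc n..}" for n
    proof -
      have "(1 - fps_X ^ Suc n) * (fps_X ^ Suc n * tail_inv (Suc n) * (tail_gf n)\<^sup>2) =
          fps_X ^ Suc n * tail_gf n * (((1 - fps_X ^ Suc n) * tail_gf n) * tail_inv (Suc n))"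
        by (simp only: power2_eq_square mult_ac)
      then show ?thesis
        unfolding tail_gf_rec tail_gf_inv by (simp only: tail_gf_def atLeast_Suc_greaterThan mult_1_right)
    qed
  qed auto
  also have "\<dots> = fps_series (\<lambda>m. (tail_gf 0)\<^sup>2 * (tail_inv m)\<^sup>2 * (tail_inv 0 * (tail_gf (2 * m) - 1)))"
    using tail_double_sum[of "\<lambda>m. (tail_gf 0)\<^sup>2 * (tail_inv m)\<^sup>2"]
    unfolding tail_gf_square_expansion .
  finally show ?thesis .
qed

text \<open>For s = n + 1 the parts from s to 2 s give N(n) / N(2 s), and the even parts above 2 s
  give N(s)^2 modulo 2. With N(n) / N(s) for 1 / (1 - X^s), the ratio of
  \<open>tail_ratio_expansion\<close> appears.\<close>

lemma spt_o_plus_gf: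
  "Abs_fps (\<lambda>n. of_nat (spt_o_plus n)) =
    fps_series (\<lambda>m. tail_gf (2 * m) * (tail_inv m ^ 2)\<^sup>2 * tail_gf 0 ^ 3 *
      (tail_inv 0 * (tail_gf (2 * m) - 1)))"
proof -
  define B where "B s = {x. s \<le> x \<and> (odd x \<longrightarrow> x \<le> 2 * s)}" for s :: nat
  have gf_B: "part_gf (B (Suc n)) = tail_gf n * (tail_gf (Suc n))\<^sup>2 * tail_inv (2 * Suc n)" for n
  proof -
    have "B (Suc n) = {Suc n..2 * Suc n} \<union> (*) 2 ` {Suc n<..}"
      by (auto simp: B_def image_iff elim!: evenE)
    moreover have "{Suc n..2 * Suc n} \<inter> (*) 2 ` {Suc n<..} = {}"
      by auto
    ultimately have gf: "part_gf (B (Suc n)) = part_gf {Suc n..2 * Suc n} * (tail_gf (Suc n))\<^sup>2"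
      by (simp only: part_gf_Un part_gf_square tail_gf_def)
    have "{n<..} = {Suc n..2 * Suc n} \<union> {2 * Suc n<..}"
      by auto
    from arg_cong[OF this, of part_gf] have "tail_gf n = part_gf ({Suc n..2 * Suc n} \<union> {2 * Suc n<..})"
      unfolding tail_gf_def .
    also have "\<dots> = part_gf {Suc n..2 * Suc n} * tail_gf (2 * Suc n)"
      unfolding tail_gf_def by (rule part_gf_Un) auto
    finally have "tail_gf n = part_gf {Suc n..2 * Suc n} * tail_gf (2 * Suc n)" .
    then have "part_gf {Suc n..2 * Suc n} = tail_gf n * tail_inv (2 * Suc n)"
      by (simp only: mult.assoc tail_gf_inv mult_1_right)
    then show ?thesis
      by (simp only: gf mult_ac)
  qed
  have "{p \<in> partitions_of n. \<forall>x\<in>#p. odd x \<longrightarrow> \<not> x > 2 * smallest_part p} =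
      {p \<in> partitions_of n. set_mset p \<subseteq> B (smallest_part p)}" for n
    using smallest_part_le by (auto simp: B_def not_less)
  then have "Abs_fps (\<lambda>n. of_nat (spt_o_plus n)) = (Abs_fps (\<lambda>n. of_nat (\<Sum>p\<in>{p \<in> partitions_of n.
      set_mset p \<subseteq> B (smallest_part p)}. count p (smallest_part p))) :: bit fps)"
    unfolding spt_o_plus_def by metis
  also have "\<dots> = fps_series (\<lambda>n. fps_X ^ Suc n * tail_inv (Suc n) *
      ((tail_gf n)\<^sup>2 * (tail_gf (Suc n))\<^sup>2 * tail_inv (2 * Suc n)))"
  proof (rule smallest_part_gf)
    show "(1 - fps_X ^ Suc n) * (fps_X ^ Suc n * tail_inv (Suc n) *
        ((tail_gf n)\<^sup>2 * (tail_gf (Suc n))\<^sup>2 * tail_inv (2 * Suc n))) =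
        fps_X ^ Suc n * part_gf (B (Suc n))" for n
    proof -
      have "(1 - fps_X ^ Suc n) * (fps_X ^ Suc n * tail_inv (Suc n) *
          ((tail_gf n)\<^sup>2 * (tail_gf (Suc n))\<^sup>2 * tail_inv (2 * Suc n))) =
          fps_X ^ Suc n * (tail_gf n * (tail_gf (Suc n))\<^sup>2 * tail_inv (2 * Suc n)) *
          (((1 - fps_X ^ Suc n) * tail_gf n) * tail_inv (Suc n))"
        by (simp only: power2_eq_square[of "tail_gf n"] mult_ac)
      then show ?thesis
        unfolding tail_gf_rec tail_gf_inv gf_B by (simp only: mult_1_right)
    qed
  qed (auto simp: B_def)
  also have "\<dots> = fps_series (\<lambda>m. tail_gf (2 * m) * (tail_inv m ^ 2)\<^sup>2 * tail_gf 0 ^ 3 *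
      (tail_inv 0 * (tail_gf (2 * m) - 1)))"
    using tail_double_sum[of "\<lambda>m. tail_gf (2 * m) * (tail_inv m ^ 2)\<^sup>2 * tail_gf 0 ^ 3"]
    unfolding tail_ratio_expansion .
  finally show ?thesis .
qed

subsection \<open>The difference of the generating functions\<close>

lemma lambert_term_square: "(lambert_term c)\<^sup>2 = (lambert_term (2 * c) :: bit fps)"
  by (rule fps_ext) (auto simp: bit_fps_square_nth lambert_term_def dvd_mult_left elim!: evenE)

lemma fps_series_split_parity:
  fixes f :: "nat \<Rightarrow> 'a::comm_ring_1 fps"
  assumes "\<And>n. fps_X ^ n dvd f n"
  shows "fps_series f = fps_series (\<lambda>n. f (2 * n)) + fps_series (\<lambda>n. f (Suc (2 * n)))"
proof (rule fps_ext)
  fix k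
  have "(\<Sum>n\<le>Suc (2 * k). g n) = (\<Sum>n\<le>k. g (2 * n)) + (\<Sum>n\<le>k. g (Suc (2 * n)))"
    for g :: "nat \<Rightarrow> 'a"
    by (induction k) (simp_all add: algebra_simps)
  then show "fps_series f $ k =
      (fps_series (\<lambda>n. f (2 * n)) + fps_series (\<lambda>n. f (Suc (2 * n)))) $ k"
    using fps_series_nth[OF assms, of k "Suc (2 * k)"] by (simp add: fps_series_def)
qed

lemma progression_gf_even: "part_gf (progression (2 + 2 * m) 2) = (tail_gf m)\<^sup>2"
proof -
  have "progression (2 + 2 * m) 2 = (*) 2 ` {m<..}"
  proof (rule set_eqI)
    fix x
    have "(\<exists>i. x = 2 + 2 * m + 2 * i) \<longleftrightarrow> (\<exists>y>m. x = 2 * y)"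
      by presburger
    then show "x \<in> progression (2 + 2 * m) 2 \<longleftrightarrow> x \<in> (*) 2 ` {m<..}"
      unfolding progression_def image_iff Bex_def by simp
  qed
  then show ?thesis
    by (simp only: tail_gf_def part_gf_square)
qed

text \<open>The numbers above 2 m split into odd and even ones, and the even ones contribute
  \<open>(tail_gf m)\<^sup>2\<close>.\<close>

lemma progression_gf_odd: "part_gf (progression (1 + 2 * m) 2) = tail_gf (2 * m) * (tail_inv m)\<^sup>2"
proof -
  have "{2 * m<..} = progression (1 + 2 * m) 2 \<union> progression (2 + 2 * m) 2"
  proof (rule set_eqI)
    fix x
    have "2 * m < x \<longleftrightarrow> (\<exists>i. x = 1 + 2 * m + 2 * i) \<or> (\<exists>i. x = 2 + 2 * m + 2 * i)"
      by presburger
    then show "x \<in> {2 * m<..} \<longleftrightarrow> x \<in> progression (1 + 2 * m) 2 \<union> progression (2 + 2 * m) 2"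
      unfolding progression_def image_iff Bex_def Un_iff by simp
  qed
  moreover have "progression (1 + 2 * m) 2 \<inter> progression (2 + 2 * m) 2 = {}"
    unfolding progression_def by auto presburger
  ultimately have "tail_gf (2 * m) = part_gf (progression (1 + 2 * m) 2) * (tail_gf m)\<^sup>2"
    by (simp only: tail_gf_def[of "2 * m"] part_gf_Un progression_gf_even)
  then have "tail_gf (2 * m) * (tail_inv m)\<^sup>2 =
      part_gf (progression (1 + 2 * m) 2) * (tail_gf m * tail_inv m)\<^sup>2"
    by (simp only: power_mult_distrib mult.assoc)
  then show ?thesis
    by (simp only: tail_gf_inv one_power2 mult_1_right)
qed

lemma inverse_tail_gf_square: "inverse ((tail_gf m)\<^sup>2) = (tail_inv m)\<^sup>2"
  by (simp only: power2_eq_square fps_inverse_mult tail_inv_def)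

text \<open>Lambert terms of even index sum to the square of the full Lambert series
  \<open>l\<close>, so \<open>l = o' + l\<^sup>2\<close>. The case c = 2 of
  \<open>lambert_sum_eq\<close> gives \<open>y = l\<^sup>2\<close>, and c = 1 gives
  \<open>y + o'\<close>. The left side is thus \<open>y\<^sup>2 - (y + o')\<close>.\<close>

lemma odd_lambert_sum_eq:
  "fps_series (\<lambda>m. ((tail_inv m)\<^sup>2)\<^sup>2 - tail_gf (2 * m) * ((tail_inv m)\<^sup>2)\<^sup>2) =
    (fps_series (\<lambda>i. lambert_term (1 + 2 * i)))\<^sup>2 - fps_series (\<lambda>i. lambert_term (1 + 2 * i))"
proof -
  define y where "y = fps_series (\<lambda>m. (tail_inv m)\<^sup>2 - 1)"
  define o' where "o' = (fps_series (\<lambda>i. lambert_term (1 + 2 * i)) :: bit fps)"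
  define l where "l = (fps_series (\<lambda>i. lambert_term (Suc i)) :: bit fps)"
  have l_sq: "l\<^sup>2 = fps_series (\<lambda>i. lambert_term (2 + 2 * i))"
    unfolding l_def
    by (subst bit_fps_series_square) (simp_all add: fps_X_power_dvd_lambert_term lambert_term_square)
  have l_eq: "l = o' + l\<^sup>2"
    unfolding l_sq unfolding l_def o'_def
    by (subst fps_series_split_parity) (simp_all add: fps_X_power_dvd_lambert_term)
  have lambert: "lambert_sum c = y + fps_series (\<lambda>i. lambert_term (c + 2 * i))" if "0 < c" for c
    using lambert_sum_eq[OF that, where ?'a = bit]
    unfolding progression_gf_even inverse_tail_gf_square y_def .
  \<comment> \<open>For c = 2 the two progressions in each term coincide, so each term is 1 -
    1.\<close>
  have "lambert_sum 2 = (0 :: bit fps)"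
    by (simp add: lambert_sum_def fps_series_def fps_eq_iff)
  with lambert[of 2] have "y + l\<^sup>2 = 0"
    by (simp add: l_sq)
  then have y: "y = l\<^sup>2"
    using bit_fps_add_self[of "l\<^sup>2"] by (metis add_right_cancel)
  have "fps_series (\<lambda>m. ((tail_inv m)\<^sup>2)\<^sup>2 - 1) = y\<^sup>2"
    unfolding y_def
    by (subst bit_fps_series_square)
      (simp_all add: bit_fps_square_diff fps_X_power_dvd_square_minus_1 fps_X_power_dvd_tail)
  moreover have "fps_series (\<lambda>m. tail_gf (2 * m) * ((tail_inv m)\<^sup>2)\<^sup>2 - 1) = y + o'"
  proof -
    have "lambert_sum 1 = fps_series (\<lambda>m. tail_gf (2 * m) * ((tail_inv m)\<^sup>2)\<^sup>2 - 1)"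
      unfolding lambert_sum_def progression_gf_even progression_gf_odd inverse_tail_gf_square
      by (simp only: power2_eq_square[of "(tail_inv _)\<^sup>2"] mult.assoc)
    then show ?thesis
      using lambert[of 1] by (simp add: o'_def)
  qed
  ultimately have "fps_series (\<lambda>m. (((tail_inv m)\<^sup>2)\<^sup>2 - 1) - (tail_gf (2 * m) * ((tail_inv m)\<^sup>2)\<^sup>2 - 1)) =
      y\<^sup>2 - (y + o')"
    by (simp only: fps_series_diff)
  \<comment> \<open>Here the linear term \<open>y\<close> is read as \<open>l\<^sup>2\<close>, which
    completes the square in characteristic two.\<close>
  also have "\<dots> = (y - l)\<^sup>2 - o' "
    unfolding bit_fps_square_diff y by simp
  also have "y - l = - o'"
    using l_eq y by (metis add_diff_cancel_right' minus_diff_eq)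
  finally show ?thesis
    by (simp add: o'_def)
qed

lemma odd_lambert_sum_even_nth:
  "((fps_series (\<lambda>i. lambert_term (1 + 2 * i)))\<^sup>2 - fps_series (\<lambda>i. lambert_term (1 + 2 * i)) :: bit fps) $ (2 * n) = 0"
proof -
  have dvd: "fps_X ^ i dvd (lambert_term (1 + 2 * i) :: bit fps)" for i
    by (rule fps_X_power_dvd_lambert_term) simp
  have "1 + 2 * i dvd 2 * n \<longleftrightarrow> 1 + 2 * i dvd n" for i
    by (rule coprime_dvd_mult_right_iff) simp
  then have "lambert_term (1 + 2 * i) $ (2 * n) = (lambert_term (1 + 2 * i) $ n :: bit)" for i
    by (simp add: lambert_term_def)
  then show ?thesis
    using fps_series_nth[OF dvd, of "2 * n" "2 * n"] fps_series_nth[OF dvd, of n "2 * n"]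
    by (simp add: bit_fps_square_nth)
qed

text \<open>Squaring the series for \<open>spt\<close> acts termwise in characteristic two, so the
  two series can be subtracted term by term.\<close>

lemma spt_o_plus_gf_minus_spt_gf_square:
  "Abs_fps (\<lambda>n. of_nat (spt_o_plus n)) - (Abs_fps (\<lambda>n. of_nat (spt n)))\<^sup>2 =
    (tail_gf 0)\<^sup>2 * ((fps_series (\<lambda>i. lambert_term (1 + 2 * i)))\<^sup>2 - fps_series (\<lambda>i. lambert_term (1 + 2 * i)))"
proof -
  define a where "a m = (tail_gf 0)\<^sup>2 * (tail_inv m)\<^sup>2 * (tail_inv 0 * (tail_gf (2 * m) - 1))" for m
  have a: "fps_X ^ m dvd a m" for m
    unfolding a_def by (intro dvd_mult fps_X_power_dvd_tail) simp
  have dvd: "fps_X ^ m dvd ((tail_inv m)\<^sup>2)\<^sup>2 - tail_gf (2 * m) * ((tail_inv m)\<^sup>2)\<^sup>2" for m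
  proof -
    have "((tail_inv m)\<^sup>2)\<^sup>2 - tail_gf (2 * m) * ((tail_inv m)\<^sup>2)\<^sup>2 =
        - ((tail_inv m)\<^sup>2)\<^sup>2 * (tail_gf (2 * m) - 1)"
      by (simp add: algebra_simps)
    then show ?thesis
      by (metis dvd_mult fps_X_power_dvd_tail(1) le_SucI mult_2 le_add1)
  qed
  have diff: "tail_gf (2 * m) * ((tail_inv m)\<^sup>2)\<^sup>2 * tail_gf 0 ^ 3 * (tail_inv 0 * (tail_gf (2 * m) - 1)) - (a m)\<^sup>2 =
      (tail_gf 0)\<^sup>2 * (((tail_inv m)\<^sup>2)\<^sup>2 - tail_gf (2 * m) * ((tail_inv m)\<^sup>2)\<^sup>2)" for m
  proof -
    define N where "N = tail_gf (2 * m)"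
    define r where "r = ((tail_inv m)\<^sup>2)\<^sup>2"
    have "N * r * tail_gf 0 ^ 3 * (tail_inv 0 * (N - 1)) =
        (tail_gf 0 * tail_inv 0) * ((tail_gf 0)\<^sup>2 * r * (N * (N - 1)))"
      by (simp only: power3_eq_cube power2_eq_square mult_ac)
    moreover have "(a m)\<^sup>2 = (tail_gf 0 * tail_inv 0)\<^sup>2 * ((tail_gf 0)\<^sup>2 * r * (N - 1)\<^sup>2)"
      unfolding a_def r_def N_def power_mult_distrib by (simp only: power2_eq_square mult_ac)
    \<comment> \<open>Since (N - 1)^2 = N^2 - 1, the quadratic terms cancel: N (N - 1) - (N^2 - 1) =
      1 - N.\<close>
    moreover have "(tail_gf 0)\<^sup>2 * r * (N * (N - 1)) - (tail_gf 0)\<^sup>2 * r * (N - 1)\<^sup>2 =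
        (tail_gf 0)\<^sup>2 * (r - N * r)"
      unfolding bit_fps_square_diff by (simp add: power2_eq_square[of N] algebra_simps)
    ultimately show ?thesis
      unfolding tail_gf_inv one_power2 mult_1_left N_def[symmetric] r_def[symmetric] by (simp only:)
  qed
  have "Abs_fps (\<lambda>n. of_nat (spt_o_plus n)) - (Abs_fps (\<lambda>n. of_nat (spt n)))\<^sup>2 =
      fps_series (\<lambda>m. (tail_gf 0)\<^sup>2 * (((tail_inv m)\<^sup>2)\<^sup>2 - tail_gf (2 * m) * ((tail_inv m)\<^sup>2)\<^sup>2))"
    unfolding spt_o_plus_gf spt_gf a_def[symmetric] bit_fps_series_square[OF a]
      fps_series_diff[symmetric] diff ..
  then show ?thesis
    unfolding fps_series_mult_left[OF dvd] odd_lambert_sum_eq .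
qed

theorem theorem3:
  fixes n :: nat
  assumes "n \<ge> 1"
  shows "[spt_o_plus (2 * n) = spt n] (mod 2)"
proof -
  let ?e = "(fps_series (\<lambda>i. lambert_term (1 + 2 * i)))\<^sup>2 - fps_series (\<lambda>i. lambert_term (1 + 2 * i)) :: bit fps"
  \<comment> \<open>For odd i the square has coefficient 0; for even i the index 2 n - i is even,
    where \<open>?e\<close> vanishes.\<close>
  have "(tail_gf 0)\<^sup>2 $ i * ?e $ (2 * n - i) = 0" if "i \<le> 2 * n" for i
  proof (cases "even i")
    case True
    then have "2 * n - i = 2 * (n - i div 2)"
      by (auto elim!: evenE)
    then show ?thesis
      using odd_lambert_sum_even_nth[of "n - i div 2"] by (simp only: mult_zero_right)
  next
    case False
    then have "(tail_gf 0)\<^sup>2 $ i = 0"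
      by (simp add: bit_fps_square_nth)
    then show ?thesis
      by (simp only: mult_zero_left)
  qed
  then have "((tail_gf 0)\<^sup>2 * ?e) $ (2 * n) = 0"
    unfolding fps_mult_nth by (intro sum.neutral) simp
  then have "(of_nat (spt_o_plus (2 * n)) :: bit) = of_nat (spt n)"
    unfolding spt_o_plus_gf_minus_spt_gf_square[symmetric]
    by (simp add: bit_fps_square_nth del: minus_bit_def add_bit_eq_xor)
  then have "even (spt_o_plus (2 * n)) \<longleftrightarrow> even (spt n)"
    by (metis even_of_nat)
  then show ?thesis
    unfolding cong_def by presburger
qed

end
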